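(* Let $X$ and $Y$ be metric spaces and give $X\times Y$ the maximum metric $d((x_1,y_1),(x_2,y_2))=\max(d_X(x_1,x_2),d_Y(y_1,y_2))$. (i) If $X$ and $Y$ both have sharp measure zero, then $X\times Y$ has sharp measure zero. (ii) If $X$ has strong measure zero and $Y$ has sharp measure zero, then $X\times Y$ has strong measure zero.
   Context: A metric space $X$ has strong measure zero if for every sequence $(\varepsilon_n)$ of positive reals there is a cover $\{U_n\}$ of $X$ with $\operatorname{diam}U_n\le\varepsilon_n$ for all $n$. A gauge is a non-decreasing right-continuous $h:[0,\infty)\to[0,\infty)$ with $h(0)=0$ and $h(r)>0$ for $r>0$. $\mathcal H^h(E)=\sup_{\delta>0}\inf\{\sum_n h(\operatorname{diam}E_n)\}$, infimum over countable covers of $E$ by sets of diameter $\le\delta$; $\mathcal H^s$ uses $h(r)=r^s$; $\dim_H E=\inf\{s>0:\mathcal H^s(E)=0\}$. A metric space $X$ has sharp measure zero if for every uniformly continuous map $f:X\to Z$ into a complete metric space $Z$ there is a $\sigma$-compact $K\subseteq Z$ with $f(X)\subseteq K$ and $\dim_H K=0$. *)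

theory Defs
  imports "HOL-Analysis.Analysis"
begin

definition max_metric :: "'a metric \<Rightarrow> 'b metric \<Rightarrow> ('a \<times> 'b) metric" where
  "max_metric X Y = metric (mspace X \<times> mspace Y,
     \<lambda>(x1, y1) (x2, y2). max (mdist X x1 x2) (mdist Y y1 y2))"

lemma Metric_space_max:
  "Metric_space (mspace X \<times> mspace Y)
     (\<lambda>(x1, y1) (x2, y2). max (mdist X x1 x2) (mdist Y y1 y2))"
proof (unfold_locales, goal_cases)
  case (1 p q)
  then show ?case by (auto simp: le_max_iff_disj split: prod.split)
next
  case (2 p q)
  then show ?case by (auto simp: mdist_commute split: prod.split)
next
  case (3 p q)
  then show ?case
  proof -
    obtain x1 y1 x2 y2 where [simp]: "p = (x1, y1)" "q = (x2, y2)"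
      by (metis surj_pair)
    have "max (mdist X x1 x2) (mdist Y y1 y2) = 0 \<longleftrightarrow> mdist X x1 x2 = 0 \<and> mdist Y y1 y2 = 0"
      using mdist_nonneg[of X x1 x2] mdist_nonneg[of Y y1 y2] by linarith
    with 3 show ?thesis by simp
  qed
next
  case (4 p q r)
  obtain x1 y1 x2 y2 x3 y3 where "p = (x1, y1)" "q = (x2, y2)" "r = (x3, y3)"
    by (metis surj_pair)
  with 4 mdist_triangle[of x1 X x2 x3] mdist_triangle[of y1 Y y2 y3] show ?case
    by auto
qed

lemma mspace_max_metric [simp]: "mspace (max_metric X Y) = mspace X \<times> mspace Y"
  unfolding max_metric_def by (rule Metric_space.mspace_metric[OF Metric_space_max])

lemma mdist_max_metric [simp]:
  "mdist (max_metric X Y) (x1, y1) (x2, y2) = max (mdist X x1 x2) (mdist Y y1 y2)"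
  unfolding max_metric_def by (simp add: Metric_space.mdist_metric[OF Metric_space_max])

text \<open>The diameter is extended-valued: it is \<open>\<infinity>\<close> for unbounded sets and \<open>0\<close> for the empty set.\<close>

definition mdiam :: "'a metric \<Rightarrow> 'a set \<Rightarrow> ennreal" where
  "mdiam X S = (SUP x\<in>S. SUP y\<in>S. ennreal (mdist X x y))"

definition strong_measure_zero :: "'a metric \<Rightarrow> bool" where
  "strong_measure_zero X \<longleftrightarrow>
     (\<forall>\<epsilon> :: nat \<Rightarrow> real. (\<forall>n. \<epsilon> n > 0) \<longrightarrow>
       (\<exists>U :: nat \<Rightarrow> 'a set. (\<forall>n. U n \<subseteq> mspace X \<and> mdiam X (U n) \<le> ennreal (\<epsilon> n)) \<and>
          mspace X = (\<Union>n. U n)))"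

definition fine_covers :: "'a metric \<Rightarrow> real \<Rightarrow> 'a set \<Rightarrow> (nat \<Rightarrow> 'a set) set" where
  "fine_covers X \<delta> E =
     {C. (\<forall>n. C n \<subseteq> mspace X \<and> mdiam X (C n) \<le> ennreal \<delta>) \<and> E \<subseteq> (\<Union>n. C n)}"

text \<open>The Hausdorff measure of a gauge \<open>h\<close>. Finite covers are included among the sequences
  of sets because trailing empty sets contribute \<open>h 0 = 0\<close>; every set of a fine cover has finite
  diameter, so \<open>enn2real\<close> loses nothing.\<close>

definition hausdorff_measure :: "(real \<Rightarrow> real) \<Rightarrow> 'a metric \<Rightarrow> 'a set \<Rightarrow> ennreal" where
  "hausdorff_measure h X E =
     (SUP \<delta>\<in>{0<..}. INF C\<in>fine_covers X \<delta> E. \<Sum>n. ennreal (h (enn2real (mdiam X (C n)))))"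

definition hausdorff_dim :: "'a metric \<Rightarrow> 'a set \<Rightarrow> ennreal" where
  "hausdorff_dim X E = Inf {ennreal s | s. s > 0 \<and> hausdorff_measure (\<lambda>r. r powr s) X E = 0}"

definition sigma_compactin :: "'a topology \<Rightarrow> 'a set \<Rightarrow> bool" where
  "sigma_compactin T K \<longleftrightarrow> (\<exists>C :: nat \<Rightarrow> 'a set. (\<forall>n. compactin T (C n)) \<and> K = (\<Union>n. C n))"

text \<open>HOL cannot quantify over the type of points of the complete space \<open>Z\<close> inside a
  definition. Only the closure of \<open>f ` mspace X\<close> matters, and its points are limits of
  sequences \<open>f (x n)\<close>, so it suffices to let \<open>Z\<close> range over the metric spaces whose points are of
  type \<^typ>\<open>nat \<Rightarrow> 'a\<close>; lemma \<open>sharp_measure_zeroD\<close> below shows that the property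
  then holds for complete spaces over every type.\<close>

definition sharp_measure_zero :: "'a metric \<Rightarrow> bool" where
  "sharp_measure_zero X \<longleftrightarrow>
     (\<forall>(Z :: (nat \<Rightarrow> 'a) metric) f. mcomplete_of Z \<and> uniformly_continuous_map X Z f \<longrightarrow>
       (\<exists>K. sigma_compactin (mtopology_of Z) K \<and> f ` mspace X \<subseteq> K \<and> hausdorff_dim Z K = 0))"

lemma mdiam_isometric_image:
  assumes "\<And>x y. x \<in> S \<Longrightarrow> y \<in> S \<Longrightarrow> mdist Z (g x) (g y) = mdist W x y"
  shows "mdiam Z (g ` S) = mdiam W S"
  unfolding mdiam_def image_image using assms by (intro SUP_cong refl) simp

lemma hausdorff_measure_isometric_image_le:
  assumes iso: "\<And>x y. x \<in> mspace W \<Longrightarrow> y \<in> mspace W \<Longrightarrow> mdist Z (g x) (g y) = mdist W x y"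
    and g: "g ` mspace W \<subseteq> mspace Z"
  shows "hausdorff_measure h Z (g ` K) \<le> hausdorff_measure h W K"
  unfolding hausdorff_measure_def
proof (rule SUP_mono, rule bexI, rule INF_mono)
  fix \<delta> :: real and C
  assume C: "C \<in> fine_covers W \<delta> K"
  have diam: "mdiam Z (g ` C n) = mdiam W (C n)" for n
    using C by (intro mdiam_isometric_image iso) (auto simp: fine_covers_def)
  have "g ` C n \<subseteq> mspace Z" for n
    using C g by (auto simp: fine_covers_def)
  moreover have "g ` K \<subseteq> (\<Union>n. g ` C n)"
    using C unfolding fine_covers_def by blast
  moreover have "mdiam Z (g ` C n) \<le> ennreal \<delta>" for n
    using C by (simp add: diam fine_covers_def)
  ultimately have "(\<lambda>n. g ` C n) \<in> fine_covers Z \<delta> (g ` K)"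
    unfolding fine_covers_def by simp
  then show "\<exists>D\<in>fine_covers Z \<delta> (g ` K). (\<Sum>n. ennreal (h (enn2real (mdiam Z (D n)))))
      \<le> (\<Sum>n. ennreal (h (enn2real (mdiam W (C n)))))"
    by (rule rev_bexI) (simp add: diam)
qed

lemma hausdorff_dim_isometric_image_le:
  assumes "\<And>x y. x \<in> mspace W \<Longrightarrow> y \<in> mspace W \<Longrightarrow> mdist Z (g x) (g y) = mdist W x y"
    and "g ` mspace W \<subseteq> mspace Z"
  shows "hausdorff_dim Z (g ` K) \<le> hausdorff_dim W K"
  unfolding hausdorff_dim_def
proof (rule Inf_superset_mono, clarify)
  fix s :: real
  assume s: "0 < s" "hausdorff_measure (\<lambda>r. r powr s) W K = 0"
  then have "hausdorff_measure (\<lambda>r. r powr s) Z (g ` K) = 0"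
    using hausdorff_measure_isometric_image_le[OF assms, where h = "\<lambda>r. r powr s" and K = K] by simp
  with s show "\<exists>t. ennreal s = ennreal t \<and> t > 0 \<and> hausdorff_measure (\<lambda>r. r powr t) Z (g ` K) = 0"
    by blast
qed

lemma sharp_measure_zeroD:
  fixes X :: "'a metric" and Z :: "'z metric"
  assumes X: "sharp_measure_zero X" and Z: "mcomplete_of Z" and f: "uniformly_continuous_map X Z f"
  shows "\<exists>K. sigma_compactin (mtopology_of Z) K \<and> f ` mspace X \<subseteq> K \<and> hausdorff_dim Z K = 0"
proof -
  interpret Z: Metric_space "mspace Z" "mdist Z" by simp
  have fim: "f ` mspace X \<subseteq> mspace Z"
    using f by (auto simp: uniformly_continuous_map_def)
  define C where "C = Z.mtopology closure_of (f ` mspace X)"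
  have CZ: "C \<subseteq> mspace Z"
    unfolding C_def by (metis Z.topspace_mtopology closure_of_subset_topspace)
  have fC: "f ` mspace X \<subseteq> C"
    unfolding C_def by (simp add: closure_of_subset fim)
  have "\<exists>\<sigma>. limitin Z.mtopology (\<lambda>n. f (\<sigma> n)) z sequentially" if zC: "z \<in> C" for z
  proof -
    obtain \<tau> where \<tau>: "range \<tau> \<subseteq> f ` mspace X" "limitin Z.mtopology \<tau> z sequentially"
      using zC unfolding C_def Z.closure_of_sequentially by blast
    then have "\<forall>n. \<exists>x. \<tau> n = f x" by blast
    then obtain \<sigma> where "\<And>n. \<tau> n = f (\<sigma> n)" by metis
    with \<tau>(2) show ?thesis by (metis (no_types, lifting) ext)
  qed
  then obtain e where e: "\<And>z. z \<in> C \<Longrightarrow> limitin Z.mtopology (\<lambda>n. f (e z n)) z sequentially"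
    by metis
  have inj: "inj_on e C"
    by (rule inj_onI) (metis Z.limitin_metric_unique e sequentially_bot)
  define g where "g = inv_into C e"
  have ge: "g (e z) = z" if "z \<in> C" for z
    using inj that by (simp add: g_def)
  have gC: "g u \<in> C" if "u \<in> e ` C" for u
    using that ge by auto
  have eg: "e (g u) = u" if "u \<in> e ` C" for u
    using that ge by auto
  interpret W: Metric_space "e ` C" "\<lambda>u v. mdist Z (g u) (g v)"
  proof
    fix u v w
    show "0 \<le> mdist Z (g u) (g v)" by simp
    show "mdist Z (g u) (g v) = mdist Z (g v) (g u)" by (rule mdist_commute)
    assume uv: "u \<in> e ` C" "v \<in> e ` C"
    show "(mdist Z (g u) (g v) = 0) = (u = v)"
      using uv gC CZ eg by (metis subsetD mdist_zero)
    assume "w \<in> e ` C"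
    then show "mdist Z (g u) (g w) \<le> mdist Z (g u) (g v) + mdist Z (g v) (g w)"
      using uv gC CZ by (meson subsetD mdist_triangle)
  qed
  define W where "W = metric (e ` C, \<lambda>u v. mdist Z (g u) (g v))"
  have W [simp]: "mspace W = e ` C" "mdist W u v = mdist Z (g u) (g v)" for u v
    by (simp_all add: W_def)
  have iso: "mdist Z (g u) (g v) = mdist W u v" for u v by simp
  have gim: "g ` mspace W \<subseteq> mspace Z" using gC CZ by auto
  have "W.mcomplete"
    unfolding W.mcomplete_def
  proof (intro strip)
    fix \<sigma> assume \<sigma>: "W.MCauchy \<sigma>"
    then have r: "\<sigma> n \<in> e ` C" for n by (auto simp: W.MCauchy_def)
    have "Z.MCauchy (\<lambda>n. g (\<sigma> n))"
      using \<sigma> r gC CZ unfolding W.MCauchy_def Z.MCauchy_def by auto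
    then obtain z where z: "limitin Z.mtopology (\<lambda>n. g (\<sigma> n)) z sequentially"
      using Z unfolding mcomplete_of_def Z.mcomplete_def by blast
    moreover have "closedin Z.mtopology C" by (simp add: C_def)
    ultimately have "z \<in> C"
      using r gC unfolding Z.metric_closedin_iff_sequentially_closed by (meson image_subset_iff)
    with z r have "limitin W.mtopology \<sigma> (e z) sequentially"
      unfolding W.limit_metric_sequentially Z.limit_metric_sequentially by (simp add: ge) metis
    then show "\<exists>x. limitin W.mtopology \<sigma> x sequentially" by blast
  qed
  then have Wc: "mcomplete_of W" by (simp add: W_def)
  have ef: "g (e (f x)) = f x" if "x \<in> mspace X" for x
    using that fC ge by blast
  have "uniformly_continuous_map X W (\<lambda>x. e (f x))"
    using f fC by (auto simp: uniformly_continuous_map_def ef)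
  then obtain K where K: "sigma_compactin (mtopology_of W) K" "(\<lambda>x. e (f x)) ` mspace X \<subseteq> K"
      "hausdorff_dim W K = 0"
    using X Wc unfolding sharp_measure_zero_def by blast
  have "uniformly_continuous_map W Z g"
    using gim by (auto simp: uniformly_continuous_map_def)
  then have cont: "continuous_map (mtopology_of W) (mtopology_of Z) g"
    by (rule uniformly_continuous_imp_continuous_map)
  have "sigma_compactin (mtopology_of Z) (g ` K)"
  proof -
    obtain A :: "nat \<Rightarrow> (nat \<Rightarrow> 'a) set" where "\<And>n. compactin (mtopology_of W) (A n)" "K = (\<Union>n. A n)"
      using K(1) unfolding sigma_compactin_def by blast
    then have "(\<forall>n. compactin (mtopology_of Z) (g ` A n)) \<and> g ` K = (\<Union>n. g ` A n)"
      using image_compactin[OF _ cont] by blast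
    then show ?thesis unfolding sigma_compactin_def by (intro exI[where x = "\<lambda>n. g ` A n"])
  qed
  moreover have "f ` mspace X \<subseteq> g ` K"
    using K(2) ef by (metis (no_types, lifting) image_eqI image_subset_iff)
  moreover have "hausdorff_dim Z (g ` K) = 0"
    using hausdorff_dim_isometric_image_le[OF iso gim, of K] K(3) by simp
  ultimately show ?thesis by blast
qed

end

theory Submission
  imports Defs
begin

text \<open>Sharp measure zero is equivalent to a covering property without reference to maps or
  dimension: for every positive sequence \<open>\<epsilon>\<close> there are sets \<open>U n\<close> of diameter at most \<open>\<epsilon> n\<close> and
  pairwise disjoint finite blocks \<open>I k\<close> of indices such that every point lies in
  \<open>\<Union>n\<in>I k. U n\<close> for all but finitely many \<open>k\<close>.

  Given this, take such a cover \<open>V\<close>, \<open>J\<close> of \<open>Y\<close>, choose \<open>\<epsilon>' n\<close> below \<open>\<epsilon> m\<close> for all \<open>m \<in> J n\<close>, and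
  use the sets \<open>U n \<times> V m\<close> with \<open>m \<in> J n\<close>, where \<open>U n\<close> has diameter at most \<open>\<epsilon>' n\<close>: it is enough
  that every point of \<open>X\<close> lies in infinitely many \<open>U n\<close> (strong measure zero), and a block cover
  of \<open>X\<close> by the \<open>U n\<close> yields a block cover of the product.

  For the equivalence, a block cover by sets with very small images gives the \<open>\<sigma>\<close>-compact
  set as the union over \<open>j\<close> of \<open>\<Inter>k\<ge>j. \<Union>n\<in>I k. closure (f ` U n)\<close>. Conversely, replace the metric
  of \<open>X\<close> by a uniformly equivalent one in which \<open>\<epsilon> n\<close>-closeness follows from closeness of order
  \<open>1 / n\<close>, and pass to the completion; compact sets of dimension zero have finite covers of
  arbitrarily small total diameter \<open>\<eta>\<close>, whose \<open>i\<close>-th largest member has diameter at most \<open>\<eta> / i\<close>.\<close>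

section \<open>Block covers\<close>

lemma mdiam_le_iff:
  assumes "0 \<le> e"
  shows "mdiam X S \<le> ennreal e \<longleftrightarrow> (\<forall>x\<in>S. \<forall>y\<in>S. mdist X x y \<le> e)"
  using assms by (simp add: mdiam_def SUP_le_iff)

text \<open>Blocks need not exhaust the indices: an index outside all of them carries a filler set,
  for instance the empty one.\<close>

definition block_cover :: "'a metric \<Rightarrow> (nat \<Rightarrow> real) \<Rightarrow> (nat \<Rightarrow> 'a set) \<Rightarrow> (nat \<Rightarrow> nat set) \<Rightarrow> bool" where
  "block_cover X \<epsilon> U I \<longleftrightarrow>
     (\<forall>n. U n \<subseteq> mspace X \<and> (\<forall>x\<in>U n. \<forall>y\<in>U n. mdist X x y \<le> \<epsilon> n)) \<and>
     (\<forall>k. finite (I k)) \<and> disjoint_family I \<and>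
     (\<forall>x\<in>mspace X. \<forall>\<^sub>F k in sequentially. \<exists>n\<in>I k. x \<in> U n)"

lemma block_coverD:
  assumes "block_cover X \<epsilon> U I"
  shows "U n \<subseteq> mspace X" "\<forall>x\<in>U n. \<forall>y\<in>U n. mdist X x y \<le> \<epsilon> n" "finite (I k)" "disjoint_family I"
    "x \<in> mspace X \<Longrightarrow> \<forall>\<^sub>F k in sequentially. \<exists>n\<in>I k. x \<in> U n"
  using assms unfolding block_cover_def by blast+

definition block_coverable :: "'a metric \<Rightarrow> bool" where
  "block_coverable X \<longleftrightarrow> (\<forall>\<epsilon>. (\<forall>n. \<epsilon> n > 0) \<longrightarrow> (\<exists>U I. block_cover X \<epsilon> U I))"

text \<open>Each \<open>m < N\<close> lies in at most one block, so only finitely many blocks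
  contain an index below \<open>N\<close>.\<close>

lemma eventually_disjoint_family_ge:
  fixes I :: "nat \<Rightarrow> nat set"
  assumes "disjoint_family I"
  shows "\<forall>\<^sub>F k in sequentially. \<forall>n\<in>I k. N \<le> n"
proof -
  have "finite {k. m \<in> I k}" for m
  proof -
    have "{k. m \<in> I k} \<subseteq> {k}" if "m \<in> I k" for k
      using assms that unfolding disjoint_family_on_def by blast
    then show ?thesis
      by (metis (mono_tags, lifting) Collect_empty_eq finite.emptyI finite.insertI finite_subset)
  qed
  then have "finite (\<Union>m<N. {k. m \<in> I k})"
    by simp
  then have "\<forall>\<^sub>F k in cofinite. k \<notin> (\<Union>m<N. {k. m \<in> I k})"
    by (simp add: eventually_cofinite)
  then show ?thesis
    by (simp add: cofinite_eq_sequentially) (auto elim!: eventually_mono simp: not_less[symmetric])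
qed

section \<open>Block covers of products\<close>

definition block_product :: "(nat \<Rightarrow> 'a set) \<Rightarrow> (nat \<Rightarrow> 'b set) \<Rightarrow> (nat \<Rightarrow> nat set) \<Rightarrow> nat \<Rightarrow> ('a \<times> 'b) set" where
  "block_product U V J m = (\<Union>n\<in>{n. m \<in> J n}. U n) \<times> V m"

text \<open>By disjointness of \<open>J\<close> at most one \<open>n\<close> has
  \<open>m \<in> J n\<close>, so \<open>block_product U V J m\<close> is a single product
  \<open>U n \<times> V m\<close> or empty. As \<open>U n\<close> is paired with \<open>V m\<close>
  for every \<open>m \<in> J n\<close>, it has to meet all these bounds; \<open>insert 1\<close>
  keeps \<open>Min\<close> meaningful when \<open>J n\<close> is empty.\<close>

lemma block_product_small:
  assumes VJ: "block_cover Y \<epsilon> V J"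
    and U: "\<And>n. U n \<subseteq> mspace X" "\<And>n. \<forall>x\<in>U n. \<forall>y\<in>U n. mdist X x y \<le> Min (insert 1 (\<epsilon> ` J n))"
  shows "block_product U V J m \<subseteq> mspace (max_metric X Y)"
    and "\<forall>p\<in>block_product U V J m. \<forall>q\<in>block_product U V J m. mdist (max_metric X Y) p q \<le> \<epsilon> m"
proof -
  show "block_product U V J m \<subseteq> mspace (max_metric X Y)"
    using U(1) block_coverD(1)[OF VJ] unfolding block_product_def by fastforce
  show "\<forall>p\<in>block_product U V J m. \<forall>q\<in>block_product U V J m. mdist (max_metric X Y) p q \<le> \<epsilon> m"
  proof (intro ballI)
    fix p q
    assume p: "p \<in> block_product U V J m" and q: "q \<in> block_product U V J m"
    obtain x y n where p': "p = (x, y)" "m \<in> J n" "x \<in> U n" "y \<in> V m"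
      using p by (auto simp: block_product_def)
    obtain x' y' n' where q': "q = (x', y')" "m \<in> J n'" "x' \<in> U n'" "y' \<in> V m"
      using q by (auto simp: block_product_def)
    have "n' = n"
      using block_coverD(4)[OF VJ] p' q' unfolding disjoint_family_on_def by blast
    moreover have "Min (insert 1 (\<epsilon> ` J n)) \<le> \<epsilon> m"
      using block_coverD(3)[OF VJ] p' by (intro Min_le) auto
    ultimately have "mdist X x x' \<le> \<epsilon> m"
      using U(2)[of n] p' q' by force
    moreover have "mdist Y y y' \<le> \<epsilon> m"
      using block_coverD(2)[OF VJ] p' q' by blast
    ultimately show "mdist (max_metric X Y) p q \<le> \<epsilon> m"
      by (simp add: p' q')
  qed
qed

lemma block_cover_Min_pos:
  assumes "block_cover Y \<epsilon> V J" and "\<forall>n. \<epsilon> n > 0"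
  shows "\<forall>n. 0 < Min (insert 1 (\<epsilon> ` J n))"
  using assms by (simp add: block_cover_def)

lemma block_coverable_max_metric:
  assumes X: "block_coverable X" and Y: "block_coverable Y"
  shows "block_coverable (max_metric X Y)"
  unfolding block_coverable_def
proof (intro allI impI)
  fix \<epsilon> :: "nat \<Rightarrow> real"
  assume \<epsilon>: "\<forall>n. \<epsilon> n > 0"
  then obtain V J where VJ: "block_cover Y \<epsilon> V J"
    using Y unfolding block_coverable_def by blast
  obtain U I where UI: "block_cover X (\<lambda>n. Min (insert 1 (\<epsilon> ` J n))) U I"
    using X[unfolded block_coverable_def, rule_format, of "\<lambda>n. Min (insert 1 (\<epsilon> ` J n))"]
      block_cover_Min_pos[OF VJ \<epsilon>] by blast
  \<comment> \<open>A block of \<open>X\<close> pairs each of its sets \<open>U n\<close> with the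
    whole block \<open>J n\<close> of \<open>Y\<close>.\<close>
  define L where "L j = (\<Union>n\<in>I j. J n)" for j
  have "block_cover (max_metric X Y) \<epsilon> (block_product U V J) L"
    unfolding block_cover_def
  proof (intro conjI allI)
    show "block_product U V J m \<subseteq> mspace (max_metric X Y)"
      "\<forall>p\<in>block_product U V J m. \<forall>q\<in>block_product U V J m. mdist (max_metric X Y) p q \<le> \<epsilon> m" for m
      by (rule block_product_small[OF VJ block_coverD(1,2)[OF UI]])+
    show "finite (L k)" for k
      using block_coverD(3)[OF UI] block_coverD(3)[OF VJ] by (simp add: L_def)
    show "disjoint_family L"
      unfolding disjoint_family_on_def
    proof (intro ballI impI equals0I)
      fix i j m
      assume "i \<noteq> j" "m \<in> L i \<inter> L j"
      then obtain n n' where n: "n \<in> I i" "m \<in> J n" "n' \<in> I j" "m \<in> J n'"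
        unfolding L_def by blast
      then have "n' = n"
        using block_coverD(4)[OF VJ] unfolding disjoint_family_on_def by blast
      then show False
        using n \<open>i \<noteq> j\<close> block_coverD(4)[OF UI] unfolding disjoint_family_on_def by blast
    qed
    show "\<forall>p\<in>mspace (max_metric X Y). \<forall>\<^sub>F j in sequentially. \<exists>m\<in>L j. p \<in> block_product U V J m"
    proof
      fix p
      assume p: "p \<in> mspace (max_metric X Y)"
      then obtain x y where xy: "p = (x, y)" "x \<in> mspace X" "y \<in> mspace Y"
        by auto
      have "\<forall>\<^sub>F n in sequentially. \<exists>m\<in>J n. y \<in> V m"
        by (rule block_coverD(5)[OF VJ xy(3)])
      then obtain N where N: "\<And>n. N \<le> n \<Longrightarrow> \<exists>m\<in>J n. y \<in> V m"
        unfolding eventually_sequentially by blast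
      have "\<forall>\<^sub>F j in sequentially. \<exists>n\<in>I j. x \<in> U n"
        by (rule block_coverD(5)[OF UI xy(2)])
      \<comment> \<open>The blocks of \<open>X\<close> move to infinity, so the \<open>n\<close>
        found for \<open>x\<close> eventually reaches the threshold \<open>N\<close> belonging to
        \<open>y\<close>.\<close>
      moreover have "\<forall>\<^sub>F j in sequentially. \<forall>n\<in>I j. N \<le> n"
        by (rule eventually_disjoint_family_ge[OF block_coverD(4)[OF UI]])
      ultimately show "\<forall>\<^sub>F j in sequentially. \<exists>m\<in>L j. p \<in> block_product U V J m"
      proof eventually_elim
        case (elim j)
        then obtain n m where "n \<in> I j" "x \<in> U n" "m \<in> J n" "y \<in> V m"
          using N by blast
        then show ?case
          unfolding L_def block_product_def xy(1) by blast
      qed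
    qed
  qed
  then show "\<exists>U I. block_cover (max_metric X Y) \<epsilon> U I"
    by blast
qed

section \<open>Products with a factor of strong measure zero\<close>

lemma strong_measure_zero_infinitely_often:
  fixes \<epsilon> :: "nat \<Rightarrow> real"
  assumes X: "strong_measure_zero X" and \<epsilon>: "\<forall>n. \<epsilon> n > 0"
  obtains U where "\<And>n. U n \<subseteq> mspace X" "\<And>n. \<forall>x\<in>U n. \<forall>y\<in>U n. mdist X x y \<le> \<epsilon> n"
    "\<And>x N. x \<in> mspace X \<Longrightarrow> \<exists>n\<ge>N. x \<in> U n"
proof -
  \<comment> \<open>Pairing splits \<open>\<epsilon>\<close> into infinitely many subsequences. Each
    yields a cover of all of \<open>X\<close>, and the \<open>j\<close>-th one uses only indices at
    least \<open>j\<close>, so every point is covered infinitely often.\<close>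
  have "\<exists>U. (\<forall>i. U i \<subseteq> mspace X \<and> mdiam X (U i) \<le> ennreal (\<epsilon> (prod_encode (j, i)))) \<and>
          mspace X = (\<Union>i. U i)" for j
    using X[unfolded strong_measure_zero_def, rule_format, of "\<lambda>i. \<epsilon> (prod_encode (j, i))"] \<epsilon> by blast
  then obtain U where U: "\<And>j i. U j i \<subseteq> mspace X"
      "\<And>j i. mdiam X (U j i) \<le> ennreal (\<epsilon> (prod_encode (j, i)))" "\<And>j. mspace X = (\<Union>i. U j i)"
    by metis
  define U' where "U' n = case_prod U (prod_decode n)" for n
  have U'_eq: "U' (prod_encode (j, i)) = U j i" for j i
    by (simp add: U'_def)
  show thesis
  proof
    fix n
    obtain j i where n: "n = prod_encode (j, i)"
      by (metis prod_decode_inverse surj_pair)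
    show "U' n \<subseteq> mspace X"
      using U by (simp add: n U'_eq)
    show "\<forall>x\<in>U' n. \<forall>y\<in>U' n. mdist X x y \<le> \<epsilon> n"
      using U(2)[of j i] \<epsilon> by (simp add: n U'_eq mdiam_le_iff less_imp_le)
  next
    fix x N
    assume "x \<in> mspace X"
    then obtain i where "x \<in> U N i"
      using U(3)[of N] by blast
    then show "\<exists>n\<ge>N. x \<in> U' n"
      by (metis U'_eq le_prod_encode_1)
  qed
qed

lemma strong_measure_zero_max_metric:
  assumes X: "strong_measure_zero X" and Y: "block_coverable Y"
  shows "strong_measure_zero (max_metric X Y)"
  unfolding strong_measure_zero_def
proof (intro allI impI)
  fix \<epsilon> :: "nat \<Rightarrow> real"
  assume \<epsilon>: "\<forall>n. \<epsilon> n > 0"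
  then obtain V J where VJ: "block_cover Y \<epsilon> V J"
    using Y unfolding block_coverable_def by blast
  obtain U where U: "\<And>n. U n \<subseteq> mspace X"
    "\<And>n. \<forall>x\<in>U n. \<forall>y\<in>U n. mdist X x y \<le> Min (insert 1 (\<epsilon> ` J n))"
    "\<And>x N. x \<in> mspace X \<Longrightarrow> \<exists>n\<ge>N. x \<in> U n"
    using strong_measure_zero_infinitely_often[OF X block_cover_Min_pos[OF VJ \<epsilon>]] by blast
  define W where "W = block_product U V J"
  have W_sub: "W m \<subseteq> mspace (max_metric X Y)" for m
    unfolding W_def by (rule block_product_small[OF VJ U(1,2)])
  have "mdiam (max_metric X Y) (W m) \<le> ennreal (\<epsilon> m)" for m
    using \<epsilon> block_product_small(2)[OF VJ U(1,2)] by (simp add: W_def mdiam_le_iff less_imp_le)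
  moreover have "(x, y) \<in> (\<Union>m. W m)" if "x \<in> mspace X" "y \<in> mspace Y" for x y
  proof -
    have "\<forall>\<^sub>F n in sequentially. \<exists>m\<in>J n. y \<in> V m"
      by (rule block_coverD(5)[OF VJ that(2)])
    then obtain N where "\<And>n. N \<le> n \<Longrightarrow> \<exists>m\<in>J n. y \<in> V m"
      unfolding eventually_sequentially by blast
    \<comment> \<open>Infinitely many \<open>n\<close> with \<open>x \<in> U n\<close> suffice,
      because block \<open>J n\<close> covers \<open>y\<close> for every
      \<open>n \<ge> N\<close>.\<close>
    with U(3)[OF that(1), of N] show ?thesis
      unfolding W_def block_product_def by blast
  qed
  then have "mspace (max_metric X Y) \<subseteq> (\<Union>m. W m)"
    by auto
  ultimately show "\<exists>U. (\<forall>n. U n \<subseteq> mspace (max_metric X Y) \<and>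
      mdiam (max_metric X Y) (U n) \<le> ennreal (\<epsilon> n)) \<and> mspace (max_metric X Y) = (\<Union>n. U n)"
    using W_sub by (intro exI[of _ W]) blast
qed

section \<open>Hausdorff dimension zero\<close>

lemma hausdorff_dim_0I:
  assumes "\<And>s. 0 < s \<Longrightarrow> hausdorff_measure (\<lambda>r. r powr s) X E = 0"
  shows "hausdorff_dim X E = 0"
proof (rule ccontr)
  assume "hausdorff_dim X E \<noteq> 0"
  then have "0 < hausdorff_dim X E"
    by (simp add: zero_less_iff_neq_zero)
  then obtain y where y: "0 < y" "y < hausdorff_dim X E"
    using dense by blast
  then obtain s where s: "0 < s" "ennreal s < hausdorff_dim X E"
    by (cases y) auto
  have "hausdorff_dim X E \<le> ennreal s"
    unfolding hausdorff_dim_def using s assms by (intro Inf_lower) blast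
  with s show False
    by simp
qed

lemma hausdorff_measure_0I:
  assumes "\<And>\<delta> e. 0 < \<delta> \<Longrightarrow> 0 < e \<Longrightarrow>
      \<exists>C\<in>fine_covers X \<delta> E. (\<Sum>n. ennreal (h (enn2real (mdiam X (C n))))) \<le> ennreal e"
  shows "hausdorff_measure h X E = 0"
proof -
  have "(INF C\<in>fine_covers X \<delta> E. \<Sum>n. ennreal (h (enn2real (mdiam X (C n))))) \<le> 0" if "\<delta> > 0" for \<delta>
    by (rule ennreal_le_epsilon) (use assms[OF that] in \<open>auto intro: INF_lower2\<close>)
  then show ?thesis
    unfolding hausdorff_measure_def by (simp add: SUP_eq_iff le_zero_eq[symmetric] SUP_le_iff del: le_zero_eq)
qed

text \<open>Dimension below 1 gives some \<open>s < 1\<close> with vanishing measure. Covers of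
  fineness 1 have diameters \<open>r \<le> 1\<close>, where \<open>r \<le> r powr s\<close>, so the
  plain sum of diameters is small too.\<close>

lemma hausdorff_dim_0_imp_covers:
  assumes dim: "hausdorff_dim X E = 0" and e: "0 < e"
  obtains C where "\<And>n. C n \<subseteq> mspace X" "E \<subseteq> (\<Union>n. C n)" "\<And>n. mdiam X (C n) \<le> 1"
    "(\<Sum>n. mdiam X (C n)) < ennreal e"
proof -
  have "hausdorff_dim X E < 1"
    by (simp add: dim)
  then obtain s where s: "0 < s" "s < 1" "hausdorff_measure (\<lambda>r. r powr s) X E = 0"
    unfolding hausdorff_dim_def Inf_less_iff by (auto simp: ennreal_less_one_iff)
  have "(INF C\<in>fine_covers X 1 E. \<Sum>n. ennreal (enn2real (mdiam X (C n)) powr s)) \<le>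
      hausdorff_measure (\<lambda>r. r powr s) X E"
    unfolding hausdorff_measure_def by (rule SUP_upper2[of 1]) auto
  also have "\<dots> < ennreal e"
    using e s by simp
  finally obtain C where C: "C \<in> fine_covers X 1 E"
      "(\<Sum>n. ennreal (enn2real (mdiam X (C n)) powr s)) < ennreal e"
    by (auto simp: INF_less_iff)
  have le1: "mdiam X (C n) \<le> 1" for n
    using C by (simp add: fine_covers_def)
  have "mdiam X (C n) \<le> ennreal (enn2real (mdiam X (C n)) powr s)" for n
  proof -
    obtain r where r: "mdiam X (C n) = ennreal r" "0 \<le> r" "r \<le> 1"
      using le1[of n] by (cases "mdiam X (C n)") (auto simp: top_unique)
    have "r = r powr 1"
      using r by simp
    also have "\<dots> \<le> r powr s"
      using s r by (intro powr_mono') auto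
    finally show ?thesis
      using r by (simp add: ennreal_leI)
  qed
  then have "(\<Sum>n. mdiam X (C n)) \<le> (\<Sum>n. ennreal (enn2real (mdiam X (C n)) powr s))"
    by (intro suminf_le) auto
  then show thesis
    using C le1 by (intro that[of C]) (auto simp: fine_covers_def)
qed

section \<open>From block covers to sharp measure zero\<close>

lemma summable_exp_square:
  assumes "0 < s"
  shows "summable (\<lambda>n. exp (- real (n * n)) powr s)"
proof (rule summable_comparison_test')
  show "summable (\<lambda>n. exp (- s) ^ n)"
    using assms by (simp add: summable_geometric)
  fix n :: nat
  have "real n \<le> real (n * n)"
    by (cases n) auto
  then have "s * real n \<le> s * real (n * n)"
    using assms by (intro mult_left_mono) auto
  then show "norm (exp (- real (n * n)) powr s) \<le> exp (- s) ^ n"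
    by (simp add: powr_def exp_of_nat_mult[symmetric] mult.commute)
qed

text \<open>The bound \<open>exp (- n\<^sup>2)\<close> is summable to every positive power, so any tail of the
  sets \<open>W\<close> witnesses that \<open>K\<close> has dimension zero.\<close>

lemma block_coverable_imp_sharp_measure_zero:
  fixes X :: "'a metric"
  assumes X: "block_coverable X"
  shows "sharp_measure_zero X"
  unfolding sharp_measure_zero_def
proof (intro allI impI, elim conjE)
  fix Z :: "(nat \<Rightarrow> 'a) metric" and f
  assume Z: "mcomplete_of Z" and f: "uniformly_continuous_map X Z f"
  interpret Z: Metric_space "mspace Z" "mdist Z" by simp
  have Zc: "Z.mcomplete"
    using Z by (simp add: mcomplete_of_def)
  define \<eta> :: "nat \<Rightarrow> real" where "\<eta> n = exp (- real (n * n))" for n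
  have \<eta>: "0 < \<eta> n" for n
    by (simp add: \<eta>_def)
  have "\<exists>\<delta>>0. \<forall>x\<in>mspace X. \<forall>y\<in>mspace X. mdist X y x < \<delta> \<longrightarrow> mdist Z (f y) (f x) < \<eta> n" for n
    using f \<eta> unfolding uniformly_continuous_map_def by blast
  then obtain \<delta> where \<delta>: "\<And>n. \<delta> n > 0"
    "\<And>n x y. x \<in> mspace X \<Longrightarrow> y \<in> mspace X \<Longrightarrow> mdist X y x < \<delta> n \<Longrightarrow> mdist Z (f y) (f x) < \<eta> n"
    by metis
  \<comment> \<open>Halving turns the bound on diameters into the strict inequality used in the
    choice of \<open>\<delta>\<close>.\<close>
  obtain U I where UI: "block_cover X (\<lambda>n. \<delta> n / 2) U I"
    using X \<delta>(1) unfolding block_coverable_def by (metis half_gt_zero)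
  have fU: "f ` U n \<subseteq> mspace Z" for n
    using block_coverD(1)[OF UI] f unfolding uniformly_continuous_map_def by blast
  define W where "W n = Z.mtopology closure_of (f ` U n)" for n
  have W_closed: "closedin Z.mtopology (W n)" for n
    by (simp add: W_def)
  then have W_sub: "W n \<subseteq> mspace Z" for n
    by (metis Z.topspace_mtopology closedin_subset)
  \<comment> \<open>Closures do not enlarge the diameter: both points are approximated within
    \<open>e / 2\<close> by image points.\<close>
  have W_dist: "mdist Z u v \<le> \<eta> n" if uv: "u \<in> W n" "v \<in> W n" for u v n
  proof (rule field_le_epsilon)
    fix e :: real
    assume "0 < e"
    then have "0 < e / 2"
      by simp
    then have "\<exists>x\<in>U n. mdist Z w (f x) < e / 2" if "w \<in> W n" for w
      using that unfolding W_def Z.metric_closure_of by (auto simp del: less_divide_eq_numeral1)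
    then obtain x y where xy: "x \<in> U n" "y \<in> U n" "mdist Z u (f x) < e / 2" "mdist Z v (f y) < e / 2"
      using uv by meson
    have "mdist X y x \<le> \<delta> n / 2" "x \<in> mspace X" "y \<in> mspace X"
      using block_coverD(1,2)[OF UI, of n] xy by blast+
    then have "mdist Z (f x) (f y) < \<eta> n"
      using \<delta>(1)[of n] \<delta>(2)[of y x n] by (simp add: mdist_commute)
    moreover have "mdist Z u v \<le> mdist Z u (f x) + mdist Z (f x) v"
      using W_sub that fU xy by (intro mdist_triangle) blast+
    moreover have "mdist Z (f x) v \<le> mdist Z (f x) (f y) + mdist Z (f y) v"
      using W_sub that fU xy by (intro mdist_triangle) blast+
    ultimately show "mdist Z u v \<le> \<eta> n + e"
      using xy by (simp add: mdist_commute)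
  qed
  have far: "\<forall>\<^sub>F k in sequentially. \<forall>n\<in>I k. N \<le> n" for N
    by (rule eventually_disjoint_family_ge[OF block_coverD(4)[OF UI]])
  have finI: "finite (I k)" for k
    by (rule block_coverD(3)[OF UI])
  define B where "B k = (\<Union>n\<in>I k. W n)" for k
  \<comment> \<open>A point of \<open>X\<close> lies in every block from some \<open>j\<close> on,
    so its image lies in \<open>K j\<close>.\<close>
  define K where "K j = (\<Inter>k\<in>{j..}. B k)" for j
  have B_closed: "closedin Z.mtopology (B k)" for k
    unfolding B_def using finI W_closed by (intro closedin_Union) auto
  have K_closed: "closedin Z.mtopology (K j)" for j
    unfolding K_def using B_closed by (intro closedin_Inter) auto
  have \<eta>_lim: "\<eta> \<longlonglongrightarrow> 0"
    using summable_LIMSEQ_zero[OF summable_exp_square[of 1]] by (simp add: \<eta>_def[abs_def])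
  \<comment> \<open>Since blocks move to infinity, finitely many sets \<open>W n\<close>, all with
    \<open>n \<ge> N\<close>, already cover \<open>K j\<close>. This yields both total boundedness
    and the covers by tails.\<close>
  have K_tail: "\<exists>k\<ge>j. (\<forall>n\<in>I k. N \<le> n) \<and> K j \<subseteq> B k" for j N
  proof -
    have "\<forall>\<^sub>F k in sequentially. (\<forall>n\<in>I k. N \<le> n) \<and> j \<le> k"
      using far[of N] eventually_ge_at_top[of j] by eventually_elim simp
    then obtain k where "\<forall>n\<in>I k. N \<le> n" "j \<le> k"
      by (metis (mono_tags, lifting) eventually_sequentially order_refl)
    then show ?thesis
      unfolding K_def by auto
  qed
  have "Z.mtotally_bounded (K j)" for j
    unfolding Z.mtotally_bounded_def
  proof (intro allI impI)
    fix e :: real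
    assume "0 < e"
    then have "\<forall>\<^sub>F n in sequentially. \<eta> n < e"
      using \<eta>_lim by (simp add: order_tendstoD)
    then obtain N where N: "\<And>n. N \<le> n \<Longrightarrow> \<eta> n < e"
      unfolding eventually_sequentially by blast
    obtain k where k: "\<forall>n\<in>I k. N \<le> n" "K j \<subseteq> B k"
      using K_tail by blast
    \<comment> \<open>The net has to consist of points of \<open>K j\<close>, so a centre is chosen
      in each \<open>W n\<close> that meets \<open>K j\<close>.\<close>
    define c where "c n = (SOME z. z \<in> K j \<inter> W n)" for n
    define F where "F = c ` {n \<in> I k. K j \<inter> W n \<noteq> {}}"
    have c: "c n \<in> K j \<inter> W n" if "z \<in> K j" "z \<in> W n" for n z
      unfolding c_def by (rule someI[of _ z]) (use that in blast)
    have "z \<in> (\<Union>x\<in>F. Z.mball x e)" if z: "z \<in> K j" for z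
    proof -
      obtain n where n: "n \<in> I k" "z \<in> W n"
        using z k unfolding B_def by blast
      then have "c n \<in> F"
        using z unfolding F_def by blast
      moreover have "mdist Z (c n) z < e"
        using W_dist[of "c n" n z] c[OF z n(2)] n N[of n] k by force
      ultimately show ?thesis
        using c[OF z n(2)] W_sub n by (auto simp: Z.in_mball)
    qed
    moreover have "finite F" "F \<subseteq> K j"
      using finI c unfolding F_def by auto
    ultimately show "\<exists>F. finite F \<and> F \<subseteq> K j \<and> K j \<subseteq> (\<Union>x\<in>F. Z.mball x e)"
      by blast
  qed
  \<comment> \<open>In a complete space, closed and totally bounded sets are compact.\<close>
  then have "compactin Z.mtopology (K j)" for j
    using Z.mtotally_bounded_eq_compact_closure_of[OF Zc, of "K j"] K_closed[of j]
    by (simp add: closure_of_closedin)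
  then have "sigma_compactin (mtopology_of Z) (\<Union>j. K j)"
    unfolding sigma_compactin_def mtopology_of_def by blast
  moreover have "f x \<in> (\<Union>j. K j)" if "x \<in> mspace X" for x
  proof -
    have "\<forall>\<^sub>F k in sequentially. \<exists>n\<in>I k. x \<in> U n"
      by (rule block_coverD(5)[OF UI that])
    then obtain j where "\<And>k. j \<le> k \<Longrightarrow> \<exists>n\<in>I k. x \<in> U n"
      unfolding eventually_sequentially by blast
    moreover have "f ` U n \<subseteq> W n" for n
      unfolding W_def by (simp add: closure_of_subset fU)
    ultimately have "f x \<in> K j"
      unfolding K_def B_def by blast
    then show ?thesis
      by blast
  qed
  moreover have "hausdorff_dim Z (\<Union>j. K j) = 0"
  proof (intro hausdorff_dim_0I hausdorff_measure_0I)
    fix s \<delta> e :: real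
    assume "0 < s" "0 < \<delta>" "0 < e"
    have sm: "summable (\<lambda>n. \<eta> n powr s)"
      unfolding \<eta>_def using \<open>0 < s\<close> by (rule summable_exp_square)
    then have "(\<lambda>N. \<Sum>n. \<eta> (n + N) powr s) \<longlonglongrightarrow> 0"
      by (rule suminf_exist_split2)
    then have "\<forall>\<^sub>F N in sequentially. (\<Sum>n. \<eta> (n + N) powr s) < e"
      using \<open>0 < e\<close> by (simp add: order_tendstoD)
    moreover have "\<forall>\<^sub>F n in sequentially. \<eta> n < \<delta>"
      using \<eta>_lim \<open>0 < \<delta>\<close> by (simp add: order_tendstoD)
    ultimately obtain N where N: "(\<Sum>n. \<eta> (n + N) powr s) < e" "\<And>n. N \<le> n \<Longrightarrow> \<eta> n < \<delta>"
      unfolding eventually_sequentially by (metis le_trans linear)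
    have diam: "mdiam Z (W n) \<le> ennreal (\<eta> n)" for n
      using W_dist \<eta>[of n] by (simp add: mdiam_le_iff)
    \<comment> \<open>One tail covers every \<open>K j\<close> at once, hence their union.\<close>
    have "(\<lambda>n. W (n + N)) \<in> fine_covers Z \<delta> (\<Union>j. K j)"
      unfolding fine_covers_def
    proof (intro CollectI conjI allI)
      show "W (n + N) \<subseteq> mspace Z" for n
        by (rule W_sub)
      show "mdiam Z (W (n + N)) \<le> ennreal \<delta>" for n
        using diam[of "n + N"] N(2)[of "n + N"] by (meson ennreal_leI le_add2 less_imp_le order_trans)
      have "K j \<subseteq> (\<Union>n. W (n + N))" for j
      proof
        fix z
        assume "z \<in> K j"
        then obtain n where "N \<le> n" "z \<in> W n"
          using K_tail[of j N] unfolding B_def by blast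
        then show "z \<in> (\<Union>n. W (n + N))"
          by (metis UN_I UNIV_I le_add_diff_inverse2)
      qed
      then show "(\<Union>j. K j) \<subseteq> (\<Union>n. W (n + N))"
        by blast
    qed
    moreover have "(\<Sum>n. ennreal (enn2real (mdiam Z (W (n + N))) powr s)) \<le> ennreal e"
    proof -
      have "(\<Sum>n. ennreal (enn2real (mdiam Z (W (n + N))) powr s)) \<le> (\<Sum>n. ennreal (\<eta> (n + N) powr s))"
        using \<open>0 < s\<close> \<eta> diam
        by (intro suminf_le ennreal_leI powr_mono2) (auto intro: enn2real_leI less_imp_le)
      also have "\<dots> = ennreal (\<Sum>n. \<eta> (n + N) powr s)"
        using summable_ignore_initial_segment[OF sm] by (intro suminf_ennreal2) auto
      finally show ?thesis
        using N(1) by (meson ennreal_leI less_imp_le order_trans)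
    qed
    ultimately show "\<exists>C\<in>fine_covers Z \<delta> (\<Union>j. K j).
        (\<Sum>n. ennreal (enn2real (mdiam Z (C n)) powr s)) \<le> ennreal e"
      by (intro bexI[of _ "\<lambda>n. W (n + N)"])
  qed
  ultimately show "\<exists>K. sigma_compactin (mtopology_of Z) K \<and> f ` mspace X \<subseteq> K \<and> hausdorff_dim Z K = 0"
    by blast
qed

section \<open>From sharp measure zero to block covers\<close>

lemma ex_list_by_decreasing_weight:
  fixes r :: "'a \<Rightarrow> real"
  assumes "finite A" and "\<And>a. a \<in> A \<Longrightarrow> 0 \<le> r a"
  shows "\<exists>xs. set xs = A \<and> length xs = card A \<and> (\<forall>i<length xs. real (Suc i) * r (xs ! i) \<le> sum r A)"
  using assms
proof (induction "card A" arbitrary: A)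
  case 0
  then show ?case
    by auto
next
  case (Suc n)
  then have "A \<noteq> {}"
    by auto
  \<comment> \<open>A lightest element goes last, so the list is in decreasing order of weight. The
    earlier entries keep their bounds, as the sum only grows.\<close>
  then obtain a where a: "a \<in> A" "\<And>b. b \<in> A \<Longrightarrow> r a \<le> r b"
    using Suc.prems(1) by (metis arg_min_if_finite(1) arg_min_least)
  have "n = card (A - {a})"
    using Suc a by simp
  then obtain xs where xs: "set xs = A - {a}" "length xs = card (A - {a})"
      "\<forall>i<length xs. real (Suc i) * r (xs ! i) \<le> sum r (A - {a})"
    using Suc.hyps(1)[of "A - {a}"] Suc.prems by auto
  have len: "length (xs @ [a]) = card A"
    using xs Suc.hyps(2) \<open>n = card (A - {a})\<close> by simp
  have "real (Suc i) * r ((xs @ [a]) ! i) \<le> sum r A" if "i < length (xs @ [a])" for i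
  proof (cases "i < length xs")
    case True
    then have "real (Suc i) * r ((xs @ [a]) ! i) \<le> sum r (A - {a})"
      using xs(3) by (simp add: nth_append)
    also have "\<dots> \<le> sum r A"
      using Suc.prems by (intro sum_mono2) auto
    finally show ?thesis .
  next
    case False
    then have i: "i = length xs"
      using that by simp
    \<comment> \<open>Positions count from 0, so the last one has factor \<open>card A\<close>; that
      many copies of the least weight are at most the sum.\<close>
    then have "Suc i = card A"
      using len by simp
    then show ?thesis
      using sum_bounded_below[of A "r a" r] a(2) i by simp
  qed
  moreover have "set (xs @ [a]) = A"
    using xs(1) a(1) by auto
  ultimately show ?case
    using len by blast
qed

text \<open>Sets covering \<open>K\<close> need not be open. Small balls around their points make
  them open at little cost in diameter, compactness leaves finitely many, and listing these by
  decreasing diameter bound gives the estimate depending on \<open>i\<close>.\<close>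

lemma compact_hausdorff_dim_0_finite_cover:
  assumes D: "compactin (mtopology_of Z) D" "D \<subseteq> K" and dim: "hausdorff_dim Z K = 0" and \<eta>: "0 < \<eta>"
  obtains Cs where "D \<subseteq> \<Union>(set Cs)"
    "\<And>i u v. i < length Cs \<Longrightarrow> u \<in> Cs ! i \<Longrightarrow> v \<in> Cs ! i \<Longrightarrow> real (Suc i) * mdist Z u v < \<eta>"
proof -
  interpret Z: Metric_space "mspace Z" "mdist Z" by simp
  obtain C where C: "\<And>n. C n \<subseteq> mspace Z" "K \<subseteq> (\<Union>n. C n)" "\<And>n. mdiam Z (C n) \<le> 1"
      "(\<Sum>n. mdiam Z (C n)) < ennreal (\<eta> / 4)"
    using hausdorff_dim_0_imp_covers[OF dim, of "\<eta> / 4"] \<eta> by auto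
  define r where "r n = enn2real (mdiam Z (C n))" for n
  have r: "mdiam Z (C n) = ennreal (r n)" "0 \<le> r n" for n
    using le_less_trans[OF C(3)[of n], of top] by (simp_all add: r_def)
  \<comment> \<open>The \<open>e n\<close> add up to \<open>\<eta> / 4\<close> and each diameter
    bound grows by \<open>2 * e n\<close>, so the total stays within
    \<open>\<eta> / 4 + \<eta> / 2 < \<eta>\<close>.\<close>
  define e where "e n = \<eta> / 4 * (1 / 2) ^ Suc n" for n
  have e: "0 < e n" for n
    using \<eta> by (simp add: e_def)
  define G where "G n = (\<Union>c\<in>C n. Z.mball c (e n))" for n
  define \<rho> where "\<rho> n = r n + 2 * e n" for n
  have G_dist: "mdist Z u v \<le> \<rho> n" if uv: "u \<in> G n" "v \<in> G n" for u v n
  proof -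
    obtain a b where ab: "a \<in> C n" "b \<in> C n" "mdist Z a u < e n" "mdist Z b v < e n"
      "a \<in> mspace Z" "b \<in> mspace Z" "u \<in> mspace Z" "v \<in> mspace Z"
      using uv unfolding G_def by auto
    have "mdist Z a b \<le> r n"
      using r[of n] ab mdiam_le_iff[of "r n" Z "C n"] by auto
    moreover have "mdist Z u v \<le> mdist Z u a + mdist Z a v" "mdist Z a v \<le> mdist Z a b + mdist Z b v"
      by (rule mdist_triangle; fact)+
    ultimately show ?thesis
      using ab by (simp add: \<rho>_def mdist_commute)
  qed
  have "D \<subseteq> (\<Union>n. G n)"
  proof
    fix z
    assume "z \<in> D"
    then obtain n where "z \<in> C n"
      using D C(2) by blast
    then have "z \<in> G n"
      unfolding G_def using e[of n] C(1)[of n] by (intro UN_I[of z]) auto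
    then show "z \<in> (\<Union>n. G n)"
      by blast
  qed
  moreover have "openin Z.mtopology (G n)" for n
    unfolding G_def by (intro openin_Union) auto
  ultimately obtain \<F> where "finite \<F>" "\<F> \<subseteq> range G" "D \<subseteq> \<Union>\<F>"
    using compactinD[OF D(1), of "range G"] by (auto simp: mtopology_of_def)
  then obtain A where A: "finite A" "D \<subseteq> (\<Union>n\<in>A. G n)"
    by (metis finite_subset_image)
  have "sum \<rho> A < \<eta>"
  proof -
    have "ennreal (sum r A) = (\<Sum>n\<in>A. mdiam Z (C n))"
      using r by simp
    also have "\<dots> \<le> (\<Sum>n. mdiam Z (C n))"
      using A(1) by (intro sum_le_suminf) auto
    also note C(4)
    finally have "sum r A < \<eta> / 4"
      using \<eta> r by (simp add: ennreal_less_iff sum_nonneg)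
    moreover have "sum e A \<le> \<eta> / 4"
    proof -
      have sums: "e sums (\<eta> / 4)"
        unfolding e_def using sums_mult[OF power_half_series, of "\<eta> / 4"] by simp
      then have "sum e A \<le> suminf e"
        using A(1) e by (intro sum_le_suminf) (auto simp: sums_iff less_imp_le)
      then show ?thesis
        using sums by (simp add: sums_iff)
    qed
    ultimately show ?thesis
      using \<eta> by (simp add: \<rho>_def[abs_def] sum.distrib sum_distrib_left[symmetric])
  qed
  moreover have "0 \<le> \<rho> n" for n
    using r(2)[of n] e[of n] by (simp add: \<rho>_def)
  ultimately obtain ns where ns: "set ns = A" "\<And>i. i < length ns \<Longrightarrow> real (Suc i) * \<rho> (ns ! i) < \<eta>"
    using ex_list_by_decreasing_weight[OF A(1), of \<rho>] by force
  show thesis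
  proof
    show "D \<subseteq> \<Union>(set (map G ns))"
      using A(2) ns(1) by simp
    fix i u v
    assume i: "i < length (map G ns)" and "u \<in> map G ns ! i" "v \<in> map G ns ! i"
    then have "mdist Z u v \<le> \<rho> (ns ! i)"
      by (intro G_dist) auto
    then have "real (Suc i) * mdist Z u v \<le> real (Suc i) * \<rho> (ns ! i)"
      by (intro mult_left_mono) auto
    also have "\<dots> < \<eta>"
      using ns(2) i by simp
    finally show "real (Suc i) * mdist Z u v < \<eta>" .
  qed
qed

text \<open>The arbitrary radii \<open>\<epsilon> n\<close> are traded for radii \<open>c n\<close>
  of choice, which may decay slowly enough to be attained by finite covers of compact sets of
  dimension zero. Convergence of \<open>c\<close> to 0 makes the identity uniformly
  continuous.\<close>

lemma uniformly_equivalent_metric_slow_decay: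
  fixes c \<epsilon> :: "nat \<Rightarrow> real"
  assumes c: "\<And>n. 0 < c n" "c \<longlonglongrightarrow> 0" and \<epsilon>: "\<And>n. 0 < \<epsilon> n"
  obtains X' where "mspace X' = mspace X" "uniformly_continuous_map X X' (\<lambda>x. x)"
    "\<And>n x y. mdist X' x y < c n \<Longrightarrow> mdist X x y \<le> \<epsilon> n"
proof -
  \<comment> \<open>A supremum of truncated linear functions is subadditive, hence \<open>\<phi> \<circ> mdist X\<close> is a metric.\<close>
  define \<psi> where "\<psi> n t = min (c n) (c n / \<epsilon> n * t)" for n t
  define \<phi> where "\<phi> t = (SUP n. \<psi> n t)" for t
  have "bdd_above (range c)"
    using c(2) by (intro Bseq_bdd_above convergent_imp_Bseq) (auto simp: convergent_def)
  then obtain B where B: "c n \<le> B" for n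
    by (auto simp: bdd_above_def)
  have bdd: "bdd_above (range (\<lambda>n. \<psi> n t))" for t
    by (rule bdd_aboveI[of _ B]) (use B in \<open>auto simp: \<psi>_def min_le_iff_disj\<close>)
  have \<psi>_le: "\<psi> n t \<le> \<phi> t" for n t
    unfolding \<phi>_def by (rule cSUP_upper[OF _ bdd]) simp
  have \<psi>_pos: "0 < \<psi> n t" if "0 < t" for n t
    using that c(1)[of n] \<epsilon>[of n] by (simp add: \<psi>_def)
  have \<phi>_0: "\<phi> 0 = 0"
    using c(1) by (simp add: \<phi>_def \<psi>_def min_absorb2 less_imp_le)
  have \<phi>_pos: "0 < \<phi> t" if "0 < t" for t
    using \<psi>_pos[OF that, of 0] \<psi>_le[of 0 t] by linarith
  have \<phi>_triangle: "\<phi> t \<le> \<phi> a + \<phi> b" if "t \<le> a + b" "0 \<le> a" "0 \<le> b" for t a b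
    unfolding \<phi>_def[of t]
  proof (rule cSUP_least)
    fix n
    have q: "0 < c n / \<epsilon> n"
      using c(1)[of n] \<epsilon>[of n] by simp
    have "c n / \<epsilon> n * t \<le> c n / \<epsilon> n * a + c n / \<epsilon> n * b"
      using q that(1) by (metis distrib_left less_imp_le mult_left_mono)
    moreover have "0 \<le> c n / \<epsilon> n * a" "0 \<le> c n / \<epsilon> n * b"
      by (rule mult_nonneg_nonneg[OF less_imp_le[OF q]]; fact)+
    ultimately have "\<psi> n t \<le> \<psi> n a + \<psi> n b"
      using c(1)[of n] unfolding \<psi>_def by linarith
    then show "\<psi> n t \<le> \<phi> a + \<phi> b"
      using \<psi>_le[of n a] \<psi>_le[of n b] by linarith
  qed simp
  interpret X': Metric_space "mspace X" "\<lambda>x y. \<phi> (mdist X x y)"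
  proof
    fix x y z
    show "0 \<le> \<phi> (mdist X x y)"
      using \<phi>_0 \<phi>_pos[of "mdist X x y"] by (cases "mdist X x y = 0") (auto simp: less_le)
    show "\<phi> (mdist X x y) = \<phi> (mdist X y x)"
      by (simp add: mdist_commute)
    assume xy: "x \<in> mspace X" "y \<in> mspace X"
    show "\<phi> (mdist X x y) = 0 \<longleftrightarrow> x = y"
      using xy \<phi>_0 \<phi>_pos[of "mdist X x y"] by (metis less_irrefl mdist_nonneg mdist_zero order_le_less)
    assume "z \<in> mspace X"
    then show "\<phi> (mdist X x z) \<le> \<phi> (mdist X x y) + \<phi> (mdist X y z)"
      using xy by (intro \<phi>_triangle mdist_triangle) auto
  qed
  define X' where "X' = metric (mspace X, \<lambda>x y. \<phi> (mdist X x y))"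
  have X' [simp]: "mspace X' = mspace X" "mdist X' x y = \<phi> (mdist X x y)" for x y
    by (simp_all add: X'_def)
  \<comment> \<open>Terms with \<open>c n < a / 2\<close> are harmless for every \<open>t\<close>;
    the finitely many others are at most linear in \<open>t\<close>, so a small
    \<open>\<delta>\<close> controls them.\<close>
  have small: "\<exists>\<delta>>0. \<forall>t<\<delta>. \<phi> t < a" if "0 < a" for a
  proof -
    have "\<forall>\<^sub>F n in sequentially. c n < a / 2"
      using order_tendstoD(2)[OF c(2), of "a / 2"] that by simp
    then obtain N where N: "\<And>n. N \<le> n \<Longrightarrow> c n < a / 2"
      unfolding eventually_sequentially by blast
    define \<delta> where "\<delta> = Min (insert 1 ((\<lambda>n. a / 2 * \<epsilon> n / c n) ` {..<N}))"
    have "0 < \<delta>"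
      using that c(1) \<epsilon> by (simp add: \<delta>_def)
    moreover have "\<phi> t < a" if "t < \<delta>" for t
    proof -
      have "\<phi> t \<le> a / 2"
        unfolding \<phi>_def
      proof (rule cSUP_least)
        fix n
        show "\<psi> n t \<le> a / 2"
        proof (cases "n < N")
          case True
          then have "\<delta> \<le> a / 2 * \<epsilon> n / c n"
            unfolding \<delta>_def by (intro Min_le) auto
          then have "t \<le> a / 2 * \<epsilon> n / c n"
            using \<open>t < \<delta>\<close> by simp
          then have "c n / \<epsilon> n * t \<le> a / 2"
            using c(1)[of n] \<epsilon>[of n] by (simp add: field_simps)
          then show ?thesis
            unfolding \<psi>_def by linarith
        next
          case False
          then show ?thesis
            using N[of n] unfolding \<psi>_def by linarith
        qed
      qed simp
      then show ?thesis
        using \<open>0 < a\<close> by simp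
    qed
    ultimately show ?thesis
      by blast
  qed
  show thesis
  proof
    show "mspace X' = mspace X"
      by simp
    show "uniformly_continuous_map X X' (\<lambda>x. x)"
      using small unfolding uniformly_continuous_map_def by (auto; metis)
    fix n x y
    assume "mdist X' x y < c n"
    \<comment> \<open>As a function of \<open>t\<close>, \<open>\<psi> n t\<close> reaches its cap
      \<open>c n\<close> at \<open>t = \<epsilon> n\<close>, so a value below the cap forces
      \<open>t < \<epsilon> n\<close>.\<close>
    then have "\<psi> n (mdist X x y) < c n"
      using \<psi>_le[of n "mdist X x y"] by simp
    then have "c n / \<epsilon> n * mdist X x y < c n"
      by (simp add: \<psi>_def min_less_iff_disj)
    then show "mdist X x y \<le> \<epsilon> n"
      using c(1)[of n] \<epsilon>[of n] by (simp add: field_simps)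
  qed
qed

text \<open>Index \<open>prod_encode (k, i)\<close> is reserved for the \<open>i\<close>-th set of block \<open>k\<close>.\<close>

definition pair_weight :: "nat \<Rightarrow> real" where
  "pair_weight n = (case prod_decode n of (k, i) \<Rightarrow> 1 / (real (Suc k) * real (Suc i)))"

lemma pair_weight_pos: "0 < pair_weight n"
  by (simp add: pair_weight_def split: prod.split)

text \<open>A weight of at least \<open>a\<close> bounds both \<open>Suc k\<close> and
  \<open>Suc i\<close> by \<open>1 / a\<close>, which leaves finitely many pairs.\<close>

lemma pair_weight_tendsto_0: "pair_weight \<longlonglongrightarrow> 0"
proof (rule order_tendstoI)
  fix a :: real
  assume "0 < a"
  obtain M :: nat where M: "1 / a < real M"
    using reals_Archimedean2 by blast
  have "{n. \<not> pair_weight n < a} \<subseteq> prod_encode ` ({..M} \<times> {..M})"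
  proof
    fix n
    assume n: "n \<in> {n. \<not> pair_weight n < a}"
    obtain k i where ki: "prod_decode n = (k, i)"
      by fastforce
    have "a \<le> 1 / (real (Suc k) * real (Suc i))"
      using n by (simp add: pair_weight_def ki del: of_nat_Suc)
    then have "real (Suc k) * real (Suc i) \<le> 1 / a"
      using \<open>0 < a\<close> by (simp add: field_simps del: of_nat_Suc)
    then have "real (Suc k * Suc i) < real M"
      using M by (simp del: of_nat_Suc mult_Suc mult_Suc_right)
    then have "Suc k * Suc i < M"
      by (simp only: of_nat_less_iff)
    then have "k \<le> M" "i \<le> M"
      by simp_all
    then show "n \<in> prod_encode ` ({..M} \<times> {..M})"
      by (metis (no_types, lifting) SigmaI atMost_iff image_eqI ki prod_decode_inverse)
  qed
  then have "finite {n. \<not> pair_weight n < a}"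
    by (rule finite_subset) simp
  then show "\<forall>\<^sub>F n in sequentially. pair_weight n < a"
    by (simp add: cofinite_eq_sequentially[symmetric] eventually_cofinite)
next
  fix a :: real
  assume "a < 0"
  then show "\<forall>\<^sub>F n in sequentially. a < pair_weight n"
    using pair_weight_pos by (intro always_eventually) (meson less_trans)
qed

lemma sharp_measure_zero_imp_block_coverable:
  assumes X: "sharp_measure_zero X"
  shows "block_coverable X"
  unfolding block_coverable_def
proof (intro allI impI)
  fix \<epsilon> :: "nat \<Rightarrow> real"
  assume "\<forall>n. \<epsilon> n > 0"
  then obtain X' where X': "mspace X' = mspace X" "uniformly_continuous_map X X' (\<lambda>x. x)"
    "\<And>n x y. mdist X' x y < pair_weight n \<Longrightarrow> mdist X x y \<le> \<epsilon> n"
    using uniformly_equivalent_metric_slow_decay[OF pair_weight_pos pair_weight_tendsto_0, of \<epsilon> X] by blast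
  interpret X': Metric_space "mspace X'" "mdist X'" by simp
  \<comment> \<open>The points of this completion are functions
    \<open>'a \<Rightarrow> real\<close>, whereas the definition of sharp measure zero ranges over
    spaces of points \<open>nat \<Rightarrow> 'a\<close>; \<open>sharp_measure_zeroD\<close> bridges
    the gap.\<close>
  obtain g :: "'a \<Rightarrow> 'a \<Rightarrow> real" and Z where Z: "mcomplete_of Z" and g: "g \<in> mspace X' \<rightarrow> mspace Z"
    and iso: "\<And>x y. x \<in> mspace X' \<Longrightarrow> y \<in> mspace X' \<Longrightarrow> mdist Z (g x) (g y) = mdist X' x y"
    using X'.metric_completion by metis
  have "uniformly_continuous_map X Z g"
    using X'(2) g iso unfolding uniformly_continuous_map_def by (simp add: X'(1))
  then obtain K where K: "sigma_compactin (mtopology_of Z) K" "g ` mspace X \<subseteq> K" "hausdorff_dim Z K = 0"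
    using sharp_measure_zeroD[OF X Z] by blast
  then obtain C :: "nat \<Rightarrow> ('a \<Rightarrow> real) set" where C: "\<And>n. compactin (mtopology_of Z) (C n)" "K = (\<Union>n. C n)"
    unfolding sigma_compactin_def by blast
  \<comment> \<open>Block \<open>k\<close> covers a partial union, so a point of \<open>C m\<close>
    is covered by all blocks \<open>k \<ge> m\<close>. Total size \<open>1 / real (Suc k)\<close>
    puts the \<open>i\<close>-th set below the weight of the pair \<open>(k, i)\<close>.\<close>
  have "\<exists>Cs. (\<Union>n\<le>k. C n) \<subseteq> \<Union>(set Cs) \<and>
      (\<forall>i u v. i < length Cs \<longrightarrow> u \<in> Cs ! i \<longrightarrow> v \<in> Cs ! i \<longrightarrow> real (Suc i) * mdist Z u v < 1 / real (Suc k))" for k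
  proof (rule compact_hausdorff_dim_0_finite_cover)
    show "compactin (mtopology_of Z) (\<Union>n\<le>k. C n)"
      using C(1) by (intro compactin_Union) auto
    show "(\<Union>n\<le>k. C n) \<subseteq> K"
      using C(2) by blast
    show "0 < 1 / real (Suc k)"
      by simp
  qed (use K(3) in blast)+
  then obtain Cs where Cs: "\<And>k. (\<Union>n\<le>k. C n) \<subseteq> \<Union>(set (Cs k))"
    "\<And>k i u v. i < length (Cs k) \<Longrightarrow> u \<in> Cs k ! i \<Longrightarrow> v \<in> Cs k ! i \<Longrightarrow> real (Suc i) * mdist Z u v < 1 / real (Suc k)"
    by metis
  \<comment> \<open>Pull the covers back along \<open>g\<close>; pairs with
    \<open>i \<ge> length (Cs k)\<close> receive the empty set and lie in no block.\<close>
  define U where "U n = (case prod_decode n of (k, i) \<Rightarrow>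
      {x \<in> mspace X. i < length (Cs k) \<and> g x \<in> Cs k ! i})" for n
  define I where "I k = (\<lambda>i. prod_encode (k, i)) ` {..<length (Cs k)}" for k
  have "block_cover X \<epsilon> U I"
    unfolding block_cover_def
  proof (intro conjI allI ballI)
    fix n
    obtain k i where ki: "prod_decode n = (k, i)"
      by fastforce
    show "U n \<subseteq> mspace X"
      by (auto simp: U_def ki)
    fix x y
    assume "x \<in> U n" "y \<in> U n"
    then have xy: "x \<in> mspace X" "y \<in> mspace X" "i < length (Cs k)" "g x \<in> Cs k ! i" "g y \<in> Cs k ! i"
      by (simp_all add: U_def ki)
    then have "real (Suc i) * mdist X' x y < 1 / real (Suc k)"
      using Cs(2)[of i k "g x" "g y"] iso X'(1) by simp
    then have "mdist X' x y < pair_weight n"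
      by (simp add: pair_weight_def ki field_simps del: of_nat_Suc)
    then show "mdist X x y \<le> \<epsilon> n"
      by (rule X'(3))
  next
    show "finite (I k)" for k
      by (simp add: I_def)
    show "disjoint_family I"
      by (auto simp: disjoint_family_on_def I_def)
  next
    fix x
    assume x: "x \<in> mspace X"
    then obtain m where m: "g x \<in> C m"
      using K(2) C(2) by blast
    have "\<exists>n\<in>I k. x \<in> U n" if "m \<le> k" for k
    proof -
      have "g x \<in> \<Union>(set (Cs k))"
        using Cs(1)[of k] m that by blast
      then obtain i where i: "i < length (Cs k)" "g x \<in> Cs k ! i"
        by (metis UnionE in_set_conv_nth)
      then have "x \<in> U (prod_encode (k, i))"
        using x by (simp add: U_def)
      with i show ?thesis
        unfolding I_def by blast
    qed
    then show "\<forall>\<^sub>F k in sequentially. \<exists>n\<in>I k. x \<in> U n"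
      unfolding eventually_sequentially by blast
  qed
  then show "\<exists>U I. block_cover X \<epsilon> U I"
    by blast
qed

theorem theorem3p14:
  fixes X :: "'a metric" and Y :: "'b metric"
  shows "(sharp_measure_zero X \<and> sharp_measure_zero Y \<longrightarrow> sharp_measure_zero (max_metric X Y)) \<and>
         (strong_measure_zero X \<and> sharp_measure_zero Y \<longrightarrow> strong_measure_zero (max_metric X Y))"
proof (intro conjI impI; elim conjE)
  assume "sharp_measure_zero X" "sharp_measure_zero Y"
  then have "block_coverable (max_metric X Y)"
    by (intro block_coverable_max_metric sharp_measure_zero_imp_block_coverable)
  then show "sharp_measure_zero (max_metric X Y)"
    by (rule block_coverable_imp_sharp_measure_zero)
next
  assume "strong_measure_zero X" "sharp_measure_zero Y"
  then show "strong_measure_zero (max_metric X Y)"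
    by (intro strong_measure_zero_max_metric sharp_measure_zero_imp_block_coverable)
qed

end
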